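(* Let $(M_p)_{p\in\mathbb{N}}$ be a weight sequence satisfying (M.1), (M.2), (M.3), and let $*$ denote either $(M_p)$ (Beurling case) or $\{M_p\}$ (Roumieu case). Let $f=[(f_\varepsilon)]\in\mathcal{G}^{*}(\mathbb{R}^d)$ be such that for every $h\in\mathbb{R}^d$ the net $(f_\varepsilon(\cdot+h)-f_\varepsilon(\cdot))_{\varepsilon\in(0,1)}$ belongs to $\mathcal{N}^{*}(\mathbb{R}^d)$. Then $f$ is equal to a generalized constant: there is a net $(C_\varepsilon)\in\mathcal{E}^*_M$ of complex numbers, representing an element $C=[(C_\varepsilon)]\in\mathbb{C}^{*}$, such that $f=[(C_\varepsilon)]$ in $\mathcal{G}^{*}(\mathbb{R}^d)$, where each $C_\varepsilon$ is regarded as a constant function on $\mathbb{R}^d$.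
   Context: Conventions: $\mathbb{N}=\{0,1,2,\dots\}$, $\mathbb{Z}_+=\{1,2,\dots\}$; $\Omega=\mathbb{R}^d$ below. Functions are complex valued. For nets indexed by $\varepsilon\in(0,1)$, $a_\varepsilon=O(b_\varepsilon)$ means that there are $C>0$ and $\varepsilon_0\in(0,1)$ with $|a_\varepsilon|\le C b_\varepsilon$ for $\varepsilon\in(0,\varepsilon_0)$. All compact sets $K\subset\subset\Omega$ are assumed regular in the sense of Komatsu (Whitney-type regularity: finitely many connected components, and any two points $x,y$ of the same component can be joined by a rectifiable curve in $K$ of length at most $C_K|x-y|$). Weight sequence: $(M_p)_{p\in\mathbb{N}}$ is a sequence of positive numbers with $M_0=1$ such that, for some constants $c_0,H\ge1$: (M.1) $M_p^2\le M_{p-1}M_{p+1}$, $p\in\mathbb{Z}_+$; (M.2) $M_p\le c_0H^p\min_{0\le q\le p}M_{p-q}M_q$, $p\in\mathbb{N}$; (M.3) $\sum_{j=p+1}^\infty M_{j-1}/M_j\le c_0\,p\,M_p/M_{p+1}$, $p\in\mathbb{Z}_+$. For $\alpha\in\mathbb{N}^d$, $M_\alpha:=M_{|\alpha|}$. $M(\rho)=\sup_{p\in\mathbb{N}}\ln_+(\rho^p/M_p)$ for $\rho>0$, $M(0)=0$, where $\ln_+=\max(\ln,0)$. $\mathfrak{R}$ is the set of all positive monotonically increasing sequences $(r_i)_{i\in\mathbb{Z}_+}$ with $r_i\to\infty$; for $(r_i)\in\mathfrak{R}$, $N_{(r_i)}(\rho)=\sup_{p\in\mathbb{N}}\ln_+\big(\rho^p/(M_p\prod_{i=1}^pr_i)\big)$,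 $\rho>0$. Function spaces: for $K\subset\subset\Omega$, $h>0$, $(r_i)\in\mathfrak{R}$, $\phi\in C^\infty(\Omega)$ put $\|\phi\|_{K,h}=\sup_{x\in K,\alpha\in\mathbb{N}^d}\frac{|\phi^{(\alpha)}(x)|}{h^{|\alpha|}M_\alpha}$ and $\|\phi\|_{K,(r_i)}=\sup_{x\in K,\alpha\in\mathbb{N}^d}\frac{|\phi^{(\alpha)}(x)|}{M_\alpha\prod_{i\le|\alpha|}r_i}$. $\mathcal{E}^{(M_p)}(\Omega)$ (resp. $\mathcal{E}^{\{M_p\}}(\Omega)$) is the space of $\phi\in C^\infty(\Omega)$ with $\|\phi\|_{K,h}<\infty$ for all $K\subset\subset\Omega$, $h>0$ (resp. $\|\phi\|_{K,(r_i)}<\infty$ for all $K\subset\subset\Omega$, $(r_i)\in\mathfrak{R}$). Generalized ultradistributions: $\mathcal{E}_M^{(M_p)}(\Omega)$ is the set of nets $(g_\varepsilon)\in(\mathcal{E}^{(M_p)}(\Omega))^{(0,1)}$ such that for all $K\subset\subset\Omega$, $h>0$ there is $k\ge0$ with $\|g_\varepsilon\|_{K,h}=O(e^{M(k/\varepsilon)})$; $\mathcal{N}^{(M_p)}(\Omega)$ is the set of nets such that for all $K$, $h>0$, $k\ge0$: $\|g_\varepsilon\|_{K,h}=O(e^{-M(k/\varepsilon)})$. $\mathcal{E}_M^{\{M_p\}}(\Omega)$ is the set of nets $(g_\varepsilon)\in(\mathcal{E}^{\{M_p\}}(\Omega))^{(0,1)}$ such that for all $K\subset\subset\Omega$, $(h_i)\in\mathfrak{R}$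 there is $(k_i)\in\mathfrak{R}$ with $\|g_\varepsilon\|_{K,(h_i)}=O(e^{N_{(k_i)}(1/\varepsilon)})$; $\mathcal{N}^{\{M_p\}}(\Omega)$ is the set of nets such that for all $K$, $(h_i),(k_i)\in\mathfrak{R}$: $\|g_\varepsilon\|_{K,(h_i)}=O(e^{-N_{(k_i)}(1/\varepsilon)})$. $\mathcal{G}^*(\Omega)=\mathcal{E}_M^*(\Omega)/\mathcal{N}^*(\Omega)$; the class of $(f_\varepsilon)$ is $[(f_\varepsilon)]$. Generalized complex numbers: $\mathbb{C}^*=\mathcal{E}_M^*/\mathcal{N}_{\mathbb{C}}^*$, where $\mathcal{E}_M^{(M_p)}$ (resp. $\mathcal{E}_M^{\{M_p\}}$) is the set of nets $(c_\varepsilon)\in\mathbb{C}^{(0,1)}$ with $|c_\varepsilon|=O(e^{M(k/\varepsilon)})$ for some $k>0$ (resp. $|c_\varepsilon|=O(e^{N_{(k_i)}(1/\varepsilon)})$ for some $(k_i)\in\mathfrak{R}$), and $\mathcal{N}_{\mathbb{C}}^{(M_p)}$ (resp. $\mathcal{N}_{\mathbb{C}}^{\{M_p\}}$) is the set of nets with $|c_\varepsilon|=O(e^{-M(k/\varepsilon)})$ for every $k>0$ (resp. $|c_\varepsilon|=O(e^{-N_{(k_i)}(1/\varepsilon)})$ for every $(k_i)\in\mathfrak{R}$). *)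

theory Defs
  imports "HOL-Analysis.Analysis"
begin

section \<open>Weight sequences and associated functions\<close>

definition weight_sequence :: "(nat \<Rightarrow> real) \<Rightarrow> bool" where
  "weight_sequence M \<longleftrightarrow>
     (\<forall>p. 0 < M p) \<and> M 0 = 1 \<and>
     (\<exists>c H. 1 \<le> c \<and> 1 \<le> H \<and>
       (\<forall>p\<ge>1. (M p)\<^sup>2 \<le> M (p - 1) * M (p + 1)) \<and>
       (\<forall>p. M p \<le> c * H ^ p * Min ((\<lambda>q. M (p - q) * M q) ` {0..p})) \<and>
       (\<forall>p\<ge>1. (\<lambda>j. M (j - 1) / M j) summable_on {p + 1..} \<and>
               (\<Sum>\<^sub>\<infinity>j\<in>{p + 1..}. M (j - 1) / M j) \<le> c * real p * M p / M (p + 1)))"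

text \<open>The sequences \<open>(r\<^sub>i)\<close> are indexed by \<open>i \<ge> 1\<close>; the value \<open>r 0\<close> is never used.\<close>

definition growth_seqs :: "(nat \<Rightarrow> real) set" where
  "growth_seqs = {r. (\<forall>i\<ge>1. 0 < r i) \<and> mono_on {1..} r \<and> filterlim r at_top sequentially}"

definition seq_weight :: "(nat \<Rightarrow> real) \<Rightarrow> (nat \<Rightarrow> real) \<Rightarrow> nat \<Rightarrow> real" where
  "seq_weight M r p = M p * (\<Prod>i=1..p. r i)"

text \<open>
  \<open>assoc_fun M\<close> is the associated function of \<open>M\<close>, and \<open>assoc_fun (seq_weight M r)\<close> is
  \<open>N\<^bsub>(r\<^sub>i)\<^esub>\<close>. The supremum is a real one: the conditions on \<open>M\<close> and \<open>r\<close> imply that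
  \<open>\<rho> ^ p / M p\<close> tends to \<open>0\<close>, so the set of values is bounded.
\<close>

definition assoc_fun :: "(nat \<Rightarrow> real) \<Rightarrow> real \<Rightarrow> real" where
  "assoc_fun M \<rho> = (if \<rho> = 0 then 0 else (SUP p. max (ln (\<rho> ^ p / M p)) 0))"


section \<open>Regular compact sets\<close>

definition curve_length :: "(real \<Rightarrow> 'a::metric_space) \<Rightarrow> ennreal" where
  "curve_length \<gamma> = (SUP ts\<in>{ts. sorted ts \<and> set ts \<subseteq> {0..1}}.
     \<Sum>j<length ts - 1. ennreal (dist (\<gamma> (ts ! j)) (\<gamma> (ts ! Suc j))))"

definition regular_compact :: "'a::metric_space set \<Rightarrow> bool" where
  "regular_compact K \<longleftrightarrow> compact K \<and> finite (components K) \<and>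
     (\<exists>C>0. \<forall>S\<in>components K. \<forall>x\<in>S. \<forall>y\<in>S. \<exists>\<gamma>.
        path \<gamma> \<and> path_image \<gamma> \<subseteq> K \<and> pathstart \<gamma> = x \<and> pathfinish \<gamma> = y \<and>
        curve_length \<gamma> \<le> ennreal (C * dist x y))"


section \<open>Smooth functions and partial derivatives\<close>

definition partial_deriv ::
    "'d \<Rightarrow> (real ^ 'd::finite \<Rightarrow> complex) \<Rightarrow> real ^ 'd \<Rightarrow> complex" where
  "partial_deriv i \<phi> x = vector_derivative (\<lambda>t. \<phi> (x + t *\<^sub>R axis i 1)) (at 0)"

text \<open>All iterated partial derivatives, in every order of differentiation, are differentiable.\<close>

definition smooth :: "(real ^ 'd::finite \<Rightarrow> complex) \<Rightarrow> bool" where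
  "smooth \<phi> \<longleftrightarrow> (\<forall>ds x. foldr partial_deriv ds \<phi> differentiable (at x))"

text \<open>
  A multi-index is a function from the coordinates to \<open>nat\<close>. The index type carries no order, so
  \<open>multi_deriv\<close> differentiates along an arbitrary fixed enumeration of the coordinates; for smooth
  functions the result does not depend on it.
\<close>

definition coords :: "'d::finite list" where
  "coords = (SOME ds. distinct ds \<and> set ds = UNIV)"

definition multi_deriv ::
    "('d \<Rightarrow> nat) \<Rightarrow> (real ^ 'd::finite \<Rightarrow> complex) \<Rightarrow> real ^ 'd \<Rightarrow> complex" where
  "multi_deriv \<alpha> \<phi> = foldr (\<lambda>i. partial_deriv i ^^ \<alpha> i) coords \<phi>"

definition multi_size :: "('d::finite \<Rightarrow> nat) \<Rightarrow> nat" where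
  "multi_size \<alpha> = (\<Sum>i\<in>UNIV. \<alpha> i)"


section \<open>Ultradifferentiable functions\<close>

definition weighted_norm ::
    "(nat \<Rightarrow> real) \<Rightarrow> (real ^ 'd::finite) set \<Rightarrow> (real ^ 'd \<Rightarrow> complex) \<Rightarrow> ennreal" where
  "weighted_norm w K \<phi> =
     (SUP (x, \<alpha>)\<in>K \<times> UNIV. ennreal (cmod (multi_deriv \<alpha> \<phi> x) / w (multi_size \<alpha>)))"

definition norm_B :: "(nat \<Rightarrow> real) \<Rightarrow> (real ^ 'd::finite) set \<Rightarrow> real \<Rightarrow>
    (real ^ 'd \<Rightarrow> complex) \<Rightarrow> ennreal" where
  "norm_B M K h = weighted_norm (\<lambda>p. h ^ p * M p) K"

definition norm_R :: "(nat \<Rightarrow> real) \<Rightarrow> (real ^ 'd::finite) set \<Rightarrow> (nat \<Rightarrow> real) \<Rightarrow>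
    (real ^ 'd \<Rightarrow> complex) \<Rightarrow> ennreal" where
  "norm_R M K r = weighted_norm (seq_weight M r) K"

text \<open>The two readings of \<open>*\<close>: \<open>(M\<^sub>p)\<close> and \<open>{M\<^sub>p}\<close>.\<close>

datatype ultra_type = Beurling | Roumieu

fun ultradiff :: "ultra_type \<Rightarrow> (nat \<Rightarrow> real) \<Rightarrow> (real ^ 'd::finite \<Rightarrow> complex) set" where
  "ultradiff Beurling M =
     {\<phi>. smooth \<phi> \<and> (\<forall>K h. regular_compact K \<longrightarrow> 0 < h \<longrightarrow> norm_B M K h \<phi> < \<infinity>)}"
| "ultradiff Roumieu M =
     {\<phi>. smooth \<phi> \<and> (\<forall>K. \<forall>r\<in>growth_seqs. regular_compact K \<longrightarrow> norm_R M K r \<phi> < \<infinity>)}"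


section \<open>Generalized ultradistributions\<close>

text \<open>
  Nets indexed by \<open>(0,1)\<close> are functions on \<open>real\<close> whose values outside \<open>(0,1)\<close> are ignored: two
  nets that agree on \<open>(0,1)\<close> have the same class below.
\<close>

definition net_bigo :: "(real \<Rightarrow> ennreal) \<Rightarrow> (real \<Rightarrow> real) \<Rightarrow> bool" where
  "net_bigo a b \<longleftrightarrow>
     (\<exists>C>0. \<exists>\<epsilon>\<^sub>0\<in>{0<..<1}. \<forall>\<epsilon>\<in>{0<..<\<epsilon>\<^sub>0}. a \<epsilon> \<le> ennreal (C * b \<epsilon>))"

definition ultradiff_nets ::
    "ultra_type \<Rightarrow> (nat \<Rightarrow> real) \<Rightarrow> (real \<Rightarrow> real ^ 'd::finite \<Rightarrow> complex) set" where
  "ultradiff_nets s M = {g. \<forall>\<epsilon>\<in>{0<..<1}. g \<epsilon> \<in> ultradiff s M}"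

fun moderate_nets ::
    "ultra_type \<Rightarrow> (nat \<Rightarrow> real) \<Rightarrow> (real \<Rightarrow> real ^ 'd::finite \<Rightarrow> complex) set" where
  "moderate_nets Beurling M = {g \<in> ultradiff_nets Beurling M.
     \<forall>K h. regular_compact K \<longrightarrow> 0 < h \<longrightarrow>
       (\<exists>k\<ge>0. net_bigo (\<lambda>\<epsilon>. norm_B M K h (g \<epsilon>)) (\<lambda>\<epsilon>. exp (assoc_fun M (k / \<epsilon>))))}"
| "moderate_nets Roumieu M = {g \<in> ultradiff_nets Roumieu M.
     \<forall>K. \<forall>h\<in>growth_seqs. regular_compact K \<longrightarrow>
       (\<exists>k\<in>growth_seqs. net_bigo (\<lambda>\<epsilon>. norm_R M K h (g \<epsilon>))
                                   (\<lambda>\<epsilon>. exp (assoc_fun (seq_weight M k) (1 / \<epsilon>))))}"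

fun negligible_nets ::
    "ultra_type \<Rightarrow> (nat \<Rightarrow> real) \<Rightarrow> (real \<Rightarrow> real ^ 'd::finite \<Rightarrow> complex) set" where
  "negligible_nets Beurling M = {g \<in> ultradiff_nets Beurling M.
     \<forall>K h k. regular_compact K \<longrightarrow> 0 < h \<longrightarrow> 0 \<le> k \<longrightarrow>
       net_bigo (\<lambda>\<epsilon>. norm_B M K h (g \<epsilon>)) (\<lambda>\<epsilon>. exp (- assoc_fun M (k / \<epsilon>)))}"
| "negligible_nets Roumieu M = {g \<in> ultradiff_nets Roumieu M.
     \<forall>K. \<forall>h\<in>growth_seqs. \<forall>k\<in>growth_seqs. regular_compact K \<longrightarrow>
       net_bigo (\<lambda>\<epsilon>. norm_R M K h (g \<epsilon>))
                (\<lambda>\<epsilon>. exp (- assoc_fun (seq_weight M k) (1 / \<epsilon>)))}"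

definition net_rel :: "ultra_type \<Rightarrow> (nat \<Rightarrow> real) \<Rightarrow>
    ((real \<Rightarrow> real ^ 'd::finite \<Rightarrow> complex) \<times> (real \<Rightarrow> real ^ 'd \<Rightarrow> complex)) set" where
  "net_rel s M = {(f, g) \<in> moderate_nets s M \<times> moderate_nets s M.
     (\<lambda>\<epsilon> x. f \<epsilon> x - g \<epsilon> x) \<in> negligible_nets s M}"

definition gen_ultra ::
    "ultra_type \<Rightarrow> (nat \<Rightarrow> real) \<Rightarrow> (real \<Rightarrow> real ^ 'd::finite \<Rightarrow> complex) set set" where
  "gen_ultra s M = moderate_nets s M // net_rel s M"

definition gen_class :: "ultra_type \<Rightarrow> (nat \<Rightarrow> real) \<Rightarrow>
    (real \<Rightarrow> real ^ 'd::finite \<Rightarrow> complex) \<Rightarrow> (real \<Rightarrow> real ^ 'd \<Rightarrow> complex) set" where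
  "gen_class s M f = net_rel s M `` {f}"


section \<open>Generalized complex numbers\<close>

fun moderate_numbers :: "ultra_type \<Rightarrow> (nat \<Rightarrow> real) \<Rightarrow> (real \<Rightarrow> complex) set" where
  "moderate_numbers Beurling M =
     {c. \<exists>k>0. net_bigo (\<lambda>\<epsilon>. ennreal (cmod (c \<epsilon>))) (\<lambda>\<epsilon>. exp (assoc_fun M (k / \<epsilon>)))}"
| "moderate_numbers Roumieu M =
     {c. \<exists>k\<in>growth_seqs. net_bigo (\<lambda>\<epsilon>. ennreal (cmod (c \<epsilon>)))
           (\<lambda>\<epsilon>. exp (assoc_fun (seq_weight M k) (1 / \<epsilon>)))}"

fun negligible_numbers :: "ultra_type \<Rightarrow> (nat \<Rightarrow> real) \<Rightarrow> (real \<Rightarrow> complex) set" where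
  "negligible_numbers Beurling M =
     {c. \<forall>k>0. net_bigo (\<lambda>\<epsilon>. ennreal (cmod (c \<epsilon>))) (\<lambda>\<epsilon>. exp (- assoc_fun M (k / \<epsilon>)))}"
| "negligible_numbers Roumieu M =
     {c. \<forall>k\<in>growth_seqs. net_bigo (\<lambda>\<epsilon>. ennreal (cmod (c \<epsilon>)))
           (\<lambda>\<epsilon>. exp (- assoc_fun (seq_weight M k) (1 / \<epsilon>)))}"

definition number_rel ::
    "ultra_type \<Rightarrow> (nat \<Rightarrow> real) \<Rightarrow> ((real \<Rightarrow> complex) \<times> (real \<Rightarrow> complex)) set" where
  "number_rel s M = {(a, b) \<in> moderate_numbers s M \<times> moderate_numbers s M.
     (\<lambda>\<epsilon>. a \<epsilon> - b \<epsilon>) \<in> negligible_numbers s M}"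

definition gen_complex :: "ultra_type \<Rightarrow> (nat \<Rightarrow> real) \<Rightarrow> (real \<Rightarrow> complex) set set" where
  "gen_complex s M = moderate_numbers s M // number_rel s M"

definition number_class ::
    "ultra_type \<Rightarrow> (nat \<Rightarrow> real) \<Rightarrow> (real \<Rightarrow> complex) \<Rightarrow> (real \<Rightarrow> complex) set" where
  "number_class s M c = number_rel s M `` {c}"

end

theory Submission
  imports Defs
begin

text \<open>
  The constant is \<open>c\<^sub>\<epsilon> = f\<^sub>\<epsilon>(0)\<close>. For a fixed weight and a fixed rate, the sets of shifts \<open>t\<close> at
  which all derivatives satisfy
  \<open>\<bar>f\<^sub>\<epsilon>\<^sup>\<alpha>(t) - f\<^sub>\<epsilon>\<^sup>\<alpha>(0)\<bar> \<le> n b\<^sub>\<epsilon> w\<^sub>\<alpha>\<close> for all \<open>\<epsilon> < 1 / (n + 2)\<close>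
  are closed and cover the space, so by Baire one of them contains a ball: there the oscillation of
  every derivative is negligible, uniformly in the order. The mean value inequality and
  \<open>w\<^sub>p = O(w\<^sub>p\<^sub>+\<^sub>1)\<close>, which follows from (M.1), then make the
  derivatives themselves negligible on a smaller ball. The hypothesis transports the estimate to a
  ball of the same radius around any other point, and compactness finishes the proof.
\<close>

section \<open>Iterated partial derivatives\<close>

text \<open>\<open>smooth\<close> quantifies over words of coordinates, not over multi-indices.
  Turning a multi-index into a word makes smoothness applicable and lets the rules below be proved
  by list induction.\<close>

lemma multi_deriv_eq_foldr:
  "multi_deriv \<alpha> \<phi> = foldr partial_deriv (concat (map (\<lambda>i. replicate (\<alpha> i) i) coords)) \<phi>"
proof -
  have "foldr (\<lambda>i. partial_deriv i ^^ \<alpha> i) ds \<phi> =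
        foldr partial_deriv (concat (map (\<lambda>i. replicate (\<alpha> i) i) ds)) \<phi>" for ds
    by (induction ds) (simp_all add: foldr_replicate)
  then show ?thesis
    by (simp add: multi_deriv_def)
qed

lemma distinct_coords: "distinct (coords :: 'd::finite list)"
  and set_coords: "set (coords :: 'd::finite list) = UNIV"
proof -
  have "\<exists>ds :: 'd list. distinct ds \<and> set ds = UNIV"
    using finite_distinct_list[of "UNIV :: 'd set"] by auto
  then have "distinct (coords :: 'd list) \<and> set (coords :: 'd list) = UNIV"
    unfolding coords_def by (rule someI_ex)
  then show "distinct (coords :: 'd list)" "set (coords :: 'd list) = UNIV"
    by auto
qed

text \<open>The outermost partial derivative can be split off without commuting derivatives.\<close>

lemma multi_deriv_split:
  assumes "multi_size \<alpha> > 0"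
  obtains i \<beta> where "multi_deriv \<alpha> \<phi> = partial_deriv i (multi_deriv \<beta> \<phi>)"
    and "multi_size \<alpha> = Suc (multi_size \<beta>)"
proof -
  \<comment> \<open>The index i is the first coordinate of the list with positive exponent: those
    before it contribute the identity. Distinctness makes the decrement at i invisible to the rest
    of the list.\<close>
  have fold_upd: "\<exists>i\<in>set ds. \<alpha> i > 0 \<and> foldr (\<lambda>i. partial_deriv i ^^ \<alpha> i) ds \<phi> =
      partial_deriv i (foldr (\<lambda>j. partial_deriv j ^^ (\<alpha>(i := \<alpha> i - 1)) j) ds \<phi>)"
    if "distinct ds" "\<exists>i\<in>set ds. \<alpha> i > 0" for ds
    using that
  proof (induction ds)
    case Nil
    then show ?case by simp
  next
    case (Cons a ds)
    show ?case
    proof (cases "\<alpha> a")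
      case 0
      with Cons obtain i where "i \<in> set ds" "\<alpha> i > 0"
        "foldr (\<lambda>i. partial_deriv i ^^ \<alpha> i) ds \<phi> =
          partial_deriv i (foldr (\<lambda>j. partial_deriv j ^^ (\<alpha>(i := \<alpha> i - 1)) j) ds \<phi>)"
        by auto
      with 0 show ?thesis
        by (intro bexI[of _ i]) auto
    next
      case (Suc n)
      have "foldr (\<lambda>j. partial_deriv j ^^ (\<alpha>(a := \<alpha> a - 1)) j) ds \<phi> =
            foldr (\<lambda>j. partial_deriv j ^^ \<alpha> j) ds \<phi>"
        using Cons.prems(1) by (intro foldr_cong) auto
      with Suc show ?thesis
        by (intro bexI[of _ a]) auto
    qed
  qed
  have "\<exists>i. \<alpha> i > 0"
    using assms unfolding multi_size_def by (metis gr0I sum.neutral)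
  then obtain i where i: "\<alpha> i > 0" "multi_deriv \<alpha> \<phi> =
      partial_deriv i (multi_deriv (\<alpha>(i := \<alpha> i - 1)) \<phi>)"
    using fold_upd[OF distinct_coords] unfolding multi_deriv_def set_coords by auto
  have "multi_size \<alpha> = Suc (multi_size (\<alpha>(i := \<alpha> i - 1)))"
    using i(1) unfolding multi_size_def
    by (simp add: sum.remove[of UNIV i])
  with i(2) show thesis
    by (rule that)
qed

section \<open>Iterated derivatives of translates, differences and constants\<close>

lemma partial_deriv_shift: "partial_deriv i (\<lambda>x. \<phi> (x + h)) = (\<lambda>x. partial_deriv i \<phi> (x + h))"
  unfolding partial_deriv_def by (simp add: ac_simps)

lemma foldr_partial_deriv_shift:
  "foldr partial_deriv ds (\<lambda>x. \<phi> (x + h)) = (\<lambda>x. foldr partial_deriv ds \<phi> (x + h))"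
  by (induction ds) (simp_all add: partial_deriv_shift)

lemma multi_deriv_shift: "multi_deriv \<alpha> (\<lambda>x. \<phi> (x + h)) = (\<lambda>x. multi_deriv \<alpha> \<phi> (x + h))"
  by (simp add: multi_deriv_eq_foldr foldr_partial_deriv_shift)

lemma smooth_shift:
  assumes "smooth \<phi>"
  shows "smooth (\<lambda>x. \<phi> (x + h))"
  unfolding smooth_def foldr_partial_deriv_shift
proof (intro allI)
  fix ds and x :: "real ^ 'a"
  have "foldr partial_deriv ds \<phi> differentiable (at (x + h))"
    using assms by (simp add: smooth_def)
  moreover have "(\<lambda>x. x + h) differentiable (at x)"
    by simp
  ultimately show "(\<lambda>x. foldr partial_deriv ds \<phi> (x + h)) differentiable (at x)"
    using differentiable_chain_at[of "\<lambda>x. x + h" x "foldr partial_deriv ds \<phi>"]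
    by (simp add: o_def)
qed

text \<open>\<open>partial_deriv\<close> only looks at parameter 0 of a line. By the chain rule its
  value is the total derivative applied to the axis vector, which does not depend on where the line
  is based.\<close>

lemma has_vector_derivative_partial_deriv:
  assumes "\<phi> differentiable (at (x + t *\<^sub>R axis i 1))"
  shows "((\<lambda>t. \<phi> (x + t *\<^sub>R axis i 1)) has_vector_derivative
           partial_deriv i \<phi> (x + t *\<^sub>R axis i 1)) (at t)"
proof -
  obtain D where D: "(\<phi> has_derivative D) (at (x + t *\<^sub>R axis i 1))"
    using assms by (auto simp: differentiable_def)
  \<comment> \<open>Base point and parameter are left free because two instances are needed:
    parameter 0, to evaluate \<open>partial_deriv\<close>, and parameter t, for the
    conclusion.\<close>
  have line: "((\<lambda>s. \<phi> (y + s *\<^sub>R axis i 1)) has_vector_derivative D (axis i 1)) (at r)"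
    if "y + r *\<^sub>R axis i 1 = x + t *\<^sub>R axis i 1" for y r
  proof -
    have "((\<lambda>s. y + s *\<^sub>R axis i 1) has_derivative (\<lambda>s. s *\<^sub>R axis i 1)) (at r)"
      by (auto intro!: derivative_eq_intros)
    from has_derivative_compose[OF this, of \<phi> D]
    have "((\<lambda>s. \<phi> (y + s *\<^sub>R axis i 1)) has_derivative (\<lambda>s. D (s *\<^sub>R axis i 1))) (at r)"
      using D that by simp
    then show ?thesis
      using linear_cmul[OF has_derivative_linear[OF D]] by (simp add: has_vector_derivative_def)
  qed
  have "partial_deriv i \<phi> (x + t *\<^sub>R axis i 1) = D (axis i 1)"
    unfolding partial_deriv_def by (rule vector_derivative_at[OF line]) simp
  then show ?thesis
    using line[of x t] by simp
qed

lemma partial_deriv_diff: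
  assumes "\<And>x. \<phi> differentiable (at x)" "\<And>x. \<psi> differentiable (at x)"
  shows "partial_deriv i (\<lambda>x. \<phi> x - \<psi> x) = (\<lambda>x. partial_deriv i \<phi> x - partial_deriv i \<psi> x)"
proof
  fix x
  have "((\<lambda>t. \<phi> (x + t *\<^sub>R axis i 1) - \<psi> (x + t *\<^sub>R axis i 1)) has_vector_derivative
          partial_deriv i \<phi> x - partial_deriv i \<psi> x) (at 0)"
    using has_vector_derivative_partial_deriv[of \<phi> x 0 i]
      has_vector_derivative_partial_deriv[of \<psi> x 0 i] assms
    by (auto intro!: has_vector_derivative_diff)
  then show "partial_deriv i (\<lambda>x. \<phi> x - \<psi> x) x = partial_deriv i \<phi> x - partial_deriv i \<psi> x"
    unfolding partial_deriv_def[of i "\<lambda>x. \<phi> x - \<psi> x"] by (rule vector_derivative_at)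
qed

lemma foldr_partial_deriv_diff:
  assumes "smooth \<phi>" "smooth \<psi>"
  shows "foldr partial_deriv ds (\<lambda>x. \<phi> x - \<psi> x) =
    (\<lambda>x. foldr partial_deriv ds \<phi> x - foldr partial_deriv ds \<psi> x)"
proof (induction ds)
  case (Cons i ds)
  have "foldr partial_deriv (i # ds) (\<lambda>x. \<phi> x - \<psi> x) =
    partial_deriv i (\<lambda>x. foldr partial_deriv ds \<phi> x - foldr partial_deriv ds \<psi> x)"
    by (simp add: Cons)
  also have "\<dots> = (\<lambda>x. foldr partial_deriv (i # ds) \<phi> x - foldr partial_deriv (i # ds) \<psi> x)"
    using assms by (subst partial_deriv_diff) (auto simp: smooth_def)
  finally show ?case .
qed simp

lemma multi_deriv_diff:
  assumes "smooth \<phi>" "smooth \<psi>"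
  shows "multi_deriv \<alpha> (\<lambda>x. \<phi> x - \<psi> x) = (\<lambda>x. multi_deriv \<alpha> \<phi> x - multi_deriv \<alpha> \<psi> x)"
  by (simp add: multi_deriv_eq_foldr foldr_partial_deriv_diff assms)

lemma smooth_diff:
  assumes "smooth \<phi>" "smooth \<psi>"
  shows "smooth (\<lambda>x. \<phi> x - \<psi> x)"
  using assms unfolding smooth_def foldr_partial_deriv_diff[OF assms]
  by (auto intro!: differentiable_diff)

lemma foldr_partial_deriv_const:
  "foldr partial_deriv ds (\<lambda>x. c) = (\<lambda>x. if ds = [] then c else 0)"
  by (induction ds) (auto simp: partial_deriv_def)

lemma smooth_const: "smooth (\<lambda>x. c)"
  by (simp add: smooth_def foldr_partial_deriv_const)

lemma multi_deriv_const: "multi_deriv \<alpha> (\<lambda>x. c) = (\<lambda>x. if multi_size \<alpha> = 0 then c else 0)"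
  unfolding multi_deriv_eq_foldr foldr_partial_deriv_const
  by (auto simp: multi_size_def set_coords)

lemma multi_deriv_zero: "multi_size \<alpha> = 0 \<Longrightarrow> multi_deriv \<alpha> \<phi> = \<phi>"
proof -
  assume "multi_size \<alpha> = 0"
  then have "concat (map (\<lambda>i. replicate (\<alpha> i) i) coords) = []"
    by (auto simp: multi_size_def)
  then show ?thesis
    by (simp only: multi_deriv_eq_foldr foldr.simps id_apply)
qed

lemma multi_deriv_differentiable: "smooth \<phi> \<Longrightarrow> multi_deriv \<alpha> \<phi> differentiable (at x)"
  by (simp add: smooth_def multi_deriv_eq_foldr)

lemma continuous_on_multi_deriv: "smooth \<phi> \<Longrightarrow> continuous_on S (multi_deriv \<alpha> \<phi>)"
  by (meson continuous_at_imp_continuous_on differentiable_imp_continuous_within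
      multi_deriv_differentiable)

text \<open>By the mean value inequality the increment over the segment differs from L times the
  derivative at y by at most L * B. Hence L times the derivative is at most A + L * B in
  modulus.\<close>

lemma norm_partial_deriv_le:
  assumes diff: "\<And>x. \<phi> differentiable (at x)" and "0 < L"
    and incr: "cmod (\<phi> (y + L *\<^sub>R axis i 1) - \<phi> y) \<le> A"
    and osc: "\<And>s. s \<in> {0..L} \<Longrightarrow>
      cmod (partial_deriv i \<phi> (y + s *\<^sub>R axis i 1) - partial_deriv i \<phi> y) \<le> B"
  shows "cmod (partial_deriv i \<phi> y) \<le> A / L + B"
proof -
  let ?p = "\<lambda>s. y + s *\<^sub>R axis i 1"
  have "norm (\<phi> (?p L) - \<phi> (?p 0) - (L - 0) *\<^sub>R partial_deriv i \<phi> (?p 0)) \<le> norm (L - 0) * B"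
  proof (rule vector_differentiable_bound_linearization[where S = "{0..L}"
        and f = "\<lambda>s. \<phi> (?p s)" and f' = "\<lambda>s. partial_deriv i \<phi> (?p s)"])
    show "((\<lambda>s. \<phi> (?p s)) has_vector_derivative partial_deriv i \<phi> (?p x)) (at x within {0..L})"
      for x
      by (rule has_vector_derivative_at_within[OF has_vector_derivative_partial_deriv[OF diff]])
  qed (use \<open>0 < L\<close> osc in \<open>auto simp: closed_segment_eq_real_ivl\<close>)
  then have "cmod (L *\<^sub>R partial_deriv i \<phi> y) \<le> A + L * B"
    using incr norm_triangle_ineq4[of "\<phi> (?p L) - \<phi> y"
        "\<phi> (?p L) - \<phi> y - L *\<^sub>R partial_deriv i \<phi> y"] \<open>0 < L\<close>
    by simp
  then show ?thesis
    using \<open>0 < L\<close> by (simp add: field_simps)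
qed


section \<open>Weighted norms\<close>

text \<open>On a segment, distances are proportional to parameter increments, so the sum for a
  sorted list telescopes to at most the full distance.\<close>

lemma curve_length_linepath:
  fixes x y :: "'a::real_normed_vector"
  shows "curve_length (linepath x y) \<le> ennreal (dist x y)"
  unfolding curve_length_def
proof (rule SUP_least)
  fix ts :: "real list"
  assume "ts \<in> {ts. sorted ts \<and> set ts \<subseteq> {0..1}}"
  then have ts: "sorted ts" "set ts \<subseteq> {0..1}"
    by auto
  have "dist (linepath x y s) (linepath x y t) = (t - s) * dist x y" if "s \<le> t" for s t
  proof -
    have "linepath x y s - linepath x y t = (t - s) *\<^sub>R (x - y)"
      by (simp add: linepath_def algebra_simps)
    then show ?thesis
      using that by (simp add: dist_norm)
  qed
  then have "(\<Sum>j<length ts - 1. ennreal (dist (linepath x y (ts ! j)) (linepath x y (ts ! Suc j))))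
    = (\<Sum>j<length ts - 1. ennreal ((ts ! Suc j - ts ! j) * dist x y))"
    using ts(1) by (intro sum.cong) (auto simp: sorted_iff_nth_mono)
  also have "\<dots> = ennreal (\<Sum>j<length ts - 1. (ts ! Suc j - ts ! j) * dist x y)"
    using ts(1) by (intro sum_ennreal) (auto simp: sorted_iff_nth_mono intro!: mult_nonneg_nonneg)
  also have "(\<Sum>j<length ts - 1. (ts ! Suc j - ts ! j) * dist x y) =
      (ts ! (length ts - 1) - ts ! 0) * dist x y"
    by (simp add: sum_distrib_right[symmetric] sum_lessThan_telescope)
  also have "\<dots> \<le> 1 * dist x y"
  proof (rule mult_right_mono)
    show "ts ! (length ts - 1) - ts ! 0 \<le> 1"
    \<comment> \<open>For the empty list truncated subtraction makes both indices 0, so the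
      difference vanishes although \<open>ts ! 0\<close> is unspecified.\<close>
    proof (cases "ts = []")
      case False
      then have "ts ! (length ts - 1) \<in> {0..1}" "ts ! 0 \<in> {0..1}"
        using ts(2) by (meson diff_less length_greater_0_conv nth_mem subsetD zero_less_one)+
      then show ?thesis by simp
    qed simp
  qed simp
  finally show "(\<Sum>j<length ts - 1. ennreal (dist (linepath x y (ts ! j)) (linepath x y (ts ! Suc j))))
      \<le> ennreal (dist x y)"
    by (simp add: ennreal_leI)
qed

text \<open>Makes balls and single points admissible test sets. A convex set has at most one
  component (none if it is empty), and segments give the curves with constant 1.\<close>

lemma regular_compact_convex:
  fixes K :: "'a::real_normed_vector set"
  assumes "compact K" "convex K"
  shows "regular_compact K"
proof -
  have comp: "components K \<subseteq> {K}"
    using assms(2) convex_connected connected_eq_components_subset_sing by blast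
  have "\<exists>\<gamma>. path \<gamma> \<and> path_image \<gamma> \<subseteq> K \<and> pathstart \<gamma> = x \<and> pathfinish \<gamma> = y \<and>
      curve_length \<gamma> \<le> ennreal (1 * dist x y)" if "x \<in> K" "y \<in> K" for x y
    using that assms(2) curve_length_linepath[of x y]
    by (intro exI[of _ "linepath x y"]) (auto simp: closed_segment_subset)
  then show ?thesis
    unfolding regular_compact_def using assms(1) comp finite_subset[OF comp]
    by (intro conjI exI[of _ 1]) auto
qed

section \<open>Norm estimates as bounds on every derivative\<close>

lemma weighted_norm_le_iff:
  assumes "\<And>p. 0 < w p" "0 \<le> C"
  shows "weighted_norm w K \<phi> \<le> ennreal C \<longleftrightarrow>
    (\<forall>x\<in>K. \<forall>\<alpha>. cmod (multi_deriv \<alpha> \<phi> x) \<le> C * w (multi_size \<alpha>))"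
  unfolding weighted_norm_def SUP_le_iff using assms
  by (auto simp: pos_divide_le_eq)

lemma weighted_norm_finite_iff:
  assumes "\<And>p. 0 < w p"
  shows "weighted_norm w K \<phi> < \<infinity> \<longleftrightarrow>
    (\<exists>C\<ge>0. \<forall>x\<in>K. \<forall>\<alpha>. cmod (multi_deriv \<alpha> \<phi> x) \<le> C * w (multi_size \<alpha>))"
proof -
  have "weighted_norm w K \<phi> < \<infinity> \<longleftrightarrow> (\<exists>C\<ge>0. weighted_norm w K \<phi> \<le> ennreal C)"
    by (cases "weighted_norm w K \<phi>") (auto simp: top_unique)
  then show ?thesis
    by (simp add: weighted_norm_le_iff[of w, OF assms] cong: conj_cong)
qed

text \<open>Replaces extended nonnegative values by real inequalities; C and the threshold are
  uniform in the point and in the multi-index.\<close>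

lemma net_bigo_weighted_norm_iff:
  assumes "\<And>p. 0 < w p" "\<And>\<epsilon>. 0 \<le> b \<epsilon>"
  shows "net_bigo (\<lambda>\<epsilon>. weighted_norm w K (g \<epsilon>)) b \<longleftrightarrow>
    (\<exists>C>0. \<exists>\<epsilon>\<^sub>0\<in>{0<..<1}. \<forall>\<epsilon>\<in>{0<..<\<epsilon>\<^sub>0}. \<forall>x\<in>K. \<forall>\<alpha>.
       cmod (multi_deriv \<alpha> (g \<epsilon>) x) \<le> C * b \<epsilon> * w (multi_size \<alpha>))"
proof -
  have "weighted_norm w K (g \<epsilon>) \<le> ennreal (C * b \<epsilon>) \<longleftrightarrow>
      (\<forall>x\<in>K. \<forall>\<alpha>. cmod (multi_deriv \<alpha> (g \<epsilon>) x) \<le> C * b \<epsilon> * w (multi_size \<alpha>))"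
    if "C > 0" for C \<epsilon>
    using assms that by (intro weighted_norm_le_iff) auto
  then show ?thesis
    unfolding net_bigo_def by (meson)
qed

lemma net_bigo_weighted_normE:
  assumes "net_bigo (\<lambda>\<epsilon>. weighted_norm w K (g \<epsilon>)) b" "\<And>p. 0 < w p" "\<And>\<epsilon>. 0 \<le> b \<epsilon>"
  obtains C e where "0 < C" "e \<in> {0<..<1}"
    "\<And>\<epsilon> x \<alpha>. \<epsilon> \<in> {0<..<e} \<Longrightarrow> x \<in> K \<Longrightarrow>
       cmod (multi_deriv \<alpha> (g \<epsilon>) x) \<le> C * b \<epsilon> * w (multi_size \<alpha>)"
proof -
  have "\<exists>C>0. \<exists>e\<in>{0<..<1}. \<forall>\<epsilon>\<in>{0<..<e}. \<forall>x\<in>K. \<forall>\<alpha>.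
      cmod (multi_deriv \<alpha> (g \<epsilon>) x) \<le> C * b \<epsilon> * w (multi_size \<alpha>)"
    using assms(1) unfolding net_bigo_weighted_norm_iff[of w b, OF assms(2,3)] .
  then show thesis
    by (elim exE conjE bexE) (rule that; blast)
qed

lemma net_bigo_norm_iff:
  assumes "\<And>\<epsilon>. 0 \<le> b \<epsilon>"
  shows "net_bigo (\<lambda>\<epsilon>. ennreal (cmod (c \<epsilon>))) b \<longleftrightarrow>
    (\<exists>C>0. \<exists>\<epsilon>\<^sub>0\<in>{0<..<1}. \<forall>\<epsilon>\<in>{0<..<\<epsilon>\<^sub>0}. cmod (c \<epsilon>) \<le> C * b \<epsilon>)"
proof -
  have "ennreal (cmod (c \<epsilon>)) \<le> ennreal (C * b \<epsilon>) \<longleftrightarrow> cmod (c \<epsilon>) \<le> C * b \<epsilon>" if "C > 0" for C \<epsilon>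
    using assms[of \<epsilon>] that by simp
  then show ?thesis
    unfolding net_bigo_def by meson
qed

lemma net_bigo_normE:
  assumes "net_bigo (\<lambda>\<epsilon>. ennreal (cmod (c \<epsilon>))) b" "\<And>\<epsilon>. 0 \<le> b \<epsilon>"
  obtains C e where "0 < C" "e \<in> {0<..<1}" "\<And>\<epsilon>. \<epsilon> \<in> {0<..<e} \<Longrightarrow> cmod (c \<epsilon>) \<le> C * b \<epsilon>"
proof -
  have "\<exists>C>0. \<exists>e\<in>{0<..<1}. \<forall>\<epsilon>\<in>{0<..<e}. cmod (c \<epsilon>) \<le> C * b \<epsilon>"
    using assms(1) unfolding net_bigo_norm_iff[of b, OF assms(2)] .
  then show thesis
    by (elim exE conjE bexE) (rule that; blast)
qed

section \<open>Stability of O-estimates under algebraic operations and changes of the set\<close>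

lemma net_bigo_weighted_norm_diff:
  assumes w: "\<And>p. 0 < w p" and b: "\<And>\<epsilon>. 0 \<le> b \<epsilon>"
    and sm: "\<And>\<epsilon>. \<epsilon> \<in> {0<..<1} \<Longrightarrow> smooth (g \<epsilon>)" "\<And>\<epsilon>. \<epsilon> \<in> {0<..<1} \<Longrightarrow> smooth (h \<epsilon>)"
    and "net_bigo (\<lambda>\<epsilon>. weighted_norm w K (g \<epsilon>)) b" "net_bigo (\<lambda>\<epsilon>. weighted_norm w K (h \<epsilon>)) b"
  shows "net_bigo (\<lambda>\<epsilon>. weighted_norm w K (\<lambda>x. g \<epsilon> x - h \<epsilon> x)) b"
proof -
  obtain C1 e1 where 1: "C1 > 0" "e1 \<in> {0<..<1}" "\<And>\<epsilon> x \<alpha>. \<epsilon> \<in> {0<..<e1} \<Longrightarrow> x \<in> K \<Longrightarrow>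
      cmod (multi_deriv \<alpha> (g \<epsilon>) x) \<le> C1 * b \<epsilon> * w (multi_size \<alpha>)"
    using net_bigo_weighted_normE[OF assms(5) w b] by metis
  obtain C2 e2 where 2: "C2 > 0" "e2 \<in> {0<..<1}" "\<And>\<epsilon> x \<alpha>. \<epsilon> \<in> {0<..<e2} \<Longrightarrow> x \<in> K \<Longrightarrow>
      cmod (multi_deriv \<alpha> (h \<epsilon>) x) \<le> C2 * b \<epsilon> * w (multi_size \<alpha>)"
    using net_bigo_weighted_normE[OF assms(6) w b] by metis
  have "cmod (multi_deriv \<alpha> (\<lambda>x. g \<epsilon> x - h \<epsilon> x) x) \<le> (C1 + C2) * b \<epsilon> * w (multi_size \<alpha>)"
    if "\<epsilon> \<in> {0<..<min e1 e2}" "x \<in> K" for \<epsilon> x \<alpha>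
  proof -
    have "\<epsilon> \<in> {0<..<e1}" "\<epsilon> \<in> {0<..<e2}" "\<epsilon> \<in> {0<..<1}"
      using that 1(2) by auto
    then have "cmod (multi_deriv \<alpha> (\<lambda>x. g \<epsilon> x - h \<epsilon> x) x) \<le>
        C1 * b \<epsilon> * w (multi_size \<alpha>) + C2 * b \<epsilon> * w (multi_size \<alpha>)"
      using order_trans[OF norm_triangle_ineq4 add_mono[OF 1(3)[of \<epsilon> x \<alpha>] 2(3)[of \<epsilon> x \<alpha>]]]
        that(2) sm[of \<epsilon>]
      by (simp add: multi_deriv_diff)
    then show ?thesis
      by (simp add: algebra_simps)
  qed
  then show ?thesis
    unfolding net_bigo_weighted_norm_iff[OF w b] using 1(1,2) 2(1,2)
    by (intro exI[of _ "C1 + C2"] conjI bexI[of _ "min e1 e2"]) auto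
qed

text \<open>Writing g + h as g - (0 - h) reduces sums to the rule for differences.\<close>

lemma net_bigo_weighted_norm_add:
  assumes w: "\<And>p. 0 < w p" and b: "\<And>\<epsilon>. 0 \<le> b \<epsilon>"
    and sm: "\<And>\<epsilon>. \<epsilon> \<in> {0<..<1} \<Longrightarrow> smooth (g \<epsilon>)" "\<And>\<epsilon>. \<epsilon> \<in> {0<..<1} \<Longrightarrow> smooth (h \<epsilon>)"
    and "net_bigo (\<lambda>\<epsilon>. weighted_norm w K (g \<epsilon>)) b" "net_bigo (\<lambda>\<epsilon>. weighted_norm w K (h \<epsilon>)) b"
  shows "net_bigo (\<lambda>\<epsilon>. weighted_norm w K (\<lambda>x. g \<epsilon> x + h \<epsilon> x)) b"
proof -
  \<comment> \<open>The zero net is estimated as h - h, from which h is then subtracted once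
    more.\<close>
  have 0: "net_bigo (\<lambda>\<epsilon>. weighted_norm w K (\<lambda>x. 0 - h \<epsilon> x)) b"
    using net_bigo_weighted_norm_diff[OF w b sm(2) sm(2) assms(6) assms(6)]
      net_bigo_weighted_norm_diff[of w b "\<lambda>\<epsilon> x. h \<epsilon> x - h \<epsilon> x" h, OF w b _ sm(2) _ assms(6)]
    by (simp add: smooth_const)
  have "net_bigo (\<lambda>\<epsilon>. weighted_norm w K (\<lambda>x. g \<epsilon> x - (0 - h \<epsilon> x))) b"
    by (intro net_bigo_weighted_norm_diff w b smooth_diff smooth_const sm assms(5) 0)
  then show ?thesis
    by simp
qed

lemma net_bigo_weighted_norm_mono:
  assumes "net_bigo (\<lambda>\<epsilon>. weighted_norm w L (g \<epsilon>)) b" "K \<subseteq> L"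
  shows "net_bigo (\<lambda>\<epsilon>. weighted_norm w K (g \<epsilon>)) b"
proof -
  have "weighted_norm w K \<phi> \<le> weighted_norm w L \<phi>" for \<phi>
    unfolding weighted_norm_def using assms(2) by (intro SUP_subset_mono) auto
  then show ?thesis
    using assms(1) unfolding net_bigo_def by (meson order_trans)
qed

lemma net_bigo_weighted_norm_Un:
  assumes "\<And>\<epsilon>. 0 \<le> b \<epsilon>"
    and "net_bigo (\<lambda>\<epsilon>. weighted_norm w K (g \<epsilon>)) b" "net_bigo (\<lambda>\<epsilon>. weighted_norm w L (g \<epsilon>)) b"
  shows "net_bigo (\<lambda>\<epsilon>. weighted_norm w (K \<union> L) (g \<epsilon>)) b"
proof -
  obtain C1 e1 where 1: "C1 > 0" "e1 \<in> {0<..<1}"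
      "\<And>\<epsilon>. \<epsilon> \<in> {0<..<e1} \<Longrightarrow> weighted_norm w K (g \<epsilon>) \<le> ennreal (C1 * b \<epsilon>)"
    using assms(2) unfolding net_bigo_def by metis
  obtain C2 e2 where 2: "C2 > 0" "e2 \<in> {0<..<1}"
      "\<And>\<epsilon>. \<epsilon> \<in> {0<..<e2} \<Longrightarrow> weighted_norm w L (g \<epsilon>) \<le> ennreal (C2 * b \<epsilon>)"
    using assms(3) unfolding net_bigo_def by metis
  have "weighted_norm w (K \<union> L) (g \<epsilon>) \<le> ennreal (max C1 C2 * b \<epsilon>)"
    if "\<epsilon> \<in> {0<..<min e1 e2}" for \<epsilon>
  proof -
    have "ennreal (C1 * b \<epsilon>) \<le> ennreal (max C1 C2 * b \<epsilon>)"
         "ennreal (C2 * b \<epsilon>) \<le> ennreal (max C1 C2 * b \<epsilon>)"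
      using assms(1)[of \<epsilon>] by (auto intro!: ennreal_leI mult_right_mono)
    moreover have "weighted_norm w (K \<union> L) (g \<epsilon>) =
        sup (weighted_norm w K (g \<epsilon>)) (weighted_norm w L (g \<epsilon>))"
      unfolding weighted_norm_def by (simp add: Sigma_Un_distrib1 SUP_union)
    ultimately show ?thesis
      using 1(3)[of \<epsilon>] 2(3)[of \<epsilon>] that by (auto intro: order_trans)
  qed
  then show ?thesis
    unfolding net_bigo_def using 1(1,2) 2(1,2)
    by (intro exI[of _ "max C1 C2"] conjI bexI[of _ "min e1 e2"]) auto
qed

lemma net_bigo_weighted_norm_UN:
  assumes "\<And>p. 0 < w p" "\<And>\<epsilon>. 0 \<le> b \<epsilon>" "finite I"
    and "\<And>i. i \<in> I \<Longrightarrow> net_bigo (\<lambda>\<epsilon>. weighted_norm w (K i) (g \<epsilon>)) b"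
  shows "net_bigo (\<lambda>\<epsilon>. weighted_norm w (\<Union>i\<in>I. K i) (g \<epsilon>)) b"
  using assms(3,4)
proof (induction I rule: finite_induct)
  case empty
  show ?case
    unfolding net_bigo_weighted_norm_iff[OF assms(1,2)]
    by (intro exI[of _ 1] conjI bexI[of _ "1/2"]) auto
next
  case (insert i I)
  then show ?case
    using net_bigo_weighted_norm_Un[of b w "K i" g, OF assms(2)] by auto
qed


lemma weighted_norm_shift:
  "weighted_norm w K (\<lambda>x. \<phi> (x + h)) = weighted_norm w ((\<lambda>x. x + h) ` K) \<phi>"
  unfolding weighted_norm_def multi_deriv_shift by (rule SUP_eq) force+

text \<open>Only order 0 contributes, where the weight is \<open>w 0\<close>; hence the constant C /
  w 0.\<close>

lemma net_bigo_weighted_norm_const: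
  fixes K :: "(real ^ 'd::finite) set"
  assumes w: "\<And>p. 0 < w p" and b: "\<And>\<epsilon>. 0 \<le> b \<epsilon>"
    and "net_bigo (\<lambda>\<epsilon>. ennreal (cmod (c \<epsilon>))) b"
  shows "net_bigo (\<lambda>\<epsilon>. weighted_norm w K (\<lambda>x. c \<epsilon>)) b"
proof -
  obtain C e where C: "C > 0" "e \<in> {0<..<1}" "\<And>\<epsilon>. \<epsilon> \<in> {0<..<e} \<Longrightarrow> cmod (c \<epsilon>) \<le> C * b \<epsilon>"
    using net_bigo_normE[OF assms(3) b] by metis
  have "cmod (multi_deriv \<alpha> (\<lambda>x. c \<epsilon>) x) \<le> C / w 0 * b \<epsilon> * w (multi_size \<alpha>)"
    if "\<epsilon> \<in> {0<..<e}" for \<epsilon> \<alpha> and x :: "real ^ 'd"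
  proof (cases "multi_size \<alpha> = 0")
    case True
    then show ?thesis
      using C(3)[OF that] w[of 0] by (simp add: multi_deriv_const)
  next
    case False
    then show ?thesis
      using C(1) w[of "multi_size \<alpha>"] b[of \<epsilon>] w[of 0] by (simp add: multi_deriv_const)
  qed
  then show ?thesis
    unfolding net_bigo_weighted_norm_iff[of w b, OF w b] using C(1,2) w[of 0]
    by (intro exI[of _ "C / w 0"] conjI bexI[of _ e]) simp_all
qed

lemma net_bigo_point:
  assumes w: "\<And>p. 0 < w p" and b: "\<And>\<epsilon>. 0 \<le> b \<epsilon>"
    and "net_bigo (\<lambda>\<epsilon>. weighted_norm w K (g \<epsilon>)) b" "x \<in> K"
  shows "net_bigo (\<lambda>\<epsilon>. ennreal (cmod (g \<epsilon> x))) b"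
proof -
  obtain C e where C: "C > 0" "e \<in> {0<..<1}" "\<And>\<epsilon> x \<alpha>. \<epsilon> \<in> {0<..<e} \<Longrightarrow> x \<in> K \<Longrightarrow>
      cmod (multi_deriv \<alpha> (g \<epsilon>) x) \<le> C * b \<epsilon> * w (multi_size \<alpha>)"
    using net_bigo_weighted_normE[OF assms(3) w b] by metis
  have "cmod (g \<epsilon> x) \<le> C * w 0 * b \<epsilon>" if "\<epsilon> \<in> {0<..<e}" for \<epsilon>
    using C(3)[OF that assms(4), of "\<lambda>_. 0"]
    by (simp add: multi_deriv_zero multi_size_def mult_ac)
  then show ?thesis
    unfolding net_bigo_norm_iff[OF b] using C(1,2) w[of 0]
    by (intro exI[of _ "C * w 0"] conjI bexI[of _ e]) auto
qed


section \<open>From small differences to small derivatives\<close>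

text \<open>If all interiors were empty, the complements would be open and dense with empty
  intersection, contradicting the category theorem.\<close>

lemma baire_interior:
  fixes A :: "nat \<Rightarrow> 'a::{real_normed_vector,heine_borel} set"
  assumes "\<And>n. closed (A n)" "(\<Union>n. A n) = UNIV"
  shows "\<exists>n. interior (A n) \<noteq> {}"
proof (rule ccontr)
  assume "\<not> ?thesis"
  then have "UNIV \<subseteq> closure (\<Inter> (range (\<lambda>n. - A n)))"
    using assms(1) by (intro Baire) (auto simp: closure_complement)
  also have "\<Inter> (range (\<lambda>n. - A n)) = {}"
    using assms(2) by auto
  finally show False
    by simp
qed

text \<open>
  A derivative \<open>\<partial>\<^sub>i g\<close> whose oscillation is small, and whose mean over a segment is small
  because \<open>g\<close> itself has small oscillation, is small.
\<close>

lemma net_bigo_near_some_point: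
  fixes f :: "real \<Rightarrow> real ^ 'd::finite \<Rightarrow> complex"
  assumes w: "\<And>p. 0 < w p" and D: "\<And>p. w p \<le> D * w (Suc p)" and b: "\<And>\<epsilon>. 0 \<le> b \<epsilon>"
    and sm: "\<And>\<epsilon>. \<epsilon> \<in> {0<..<1} \<Longrightarrow> smooth (f \<epsilon>)"
    and shift: "\<And>h. net_bigo (\<lambda>\<epsilon>. weighted_norm w {0} (\<lambda>x. f \<epsilon> (x + h) - f \<epsilon> x)) b"
  obtains t r where "0 < r"
    and "net_bigo (\<lambda>\<epsilon>. weighted_norm w (cball t r) (\<lambda>x. f \<epsilon> x - f \<epsilon> t)) b"
proof -
  \<comment> \<open>One n serves both as constant and as threshold, which keeps the union countable.
    The 2 in 1 / (n + 2) keeps the threshold below 1 even for n = 0, so every f \<epsilon> involved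
    is smooth; continuity of its derivatives makes \<open>A n\<close> closed.\<close>
  define A where "A n = (\<Inter>\<epsilon>\<in>{0<..<1 / (real n + 2)}. \<Inter>\<alpha>.
    {t. cmod (multi_deriv \<alpha> (f \<epsilon>) t - multi_deriv \<alpha> (f \<epsilon>) 0) \<le> n * b \<epsilon> * w (multi_size \<alpha>)})"
    for n :: nat
  have lt1: "\<epsilon> \<in> {0<..<1}" if "\<epsilon> \<in> {0<..<1 / (real n + 2)}" for \<epsilon> n
  proof -
    have "1 / (real n + 2) < 1" by simp
    then show ?thesis
      using that by (metis greaterThanLessThan_iff order_less_trans)
  qed
  have "closed (A n)" for n
    unfolding A_def
    by (intro closed_INT ballI closed_Collect_le continuous_intros continuous_on_multi_deriv
        sm lt1)
  moreover have "\<exists>n. t \<in> A n" for t :: "real ^ 'd"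
  proof -
    obtain C e where C: "C > 0" "e \<in> {0<..<1}" "\<And>\<epsilon> \<alpha>. \<epsilon> \<in> {0<..<e} \<Longrightarrow>
        cmod (multi_deriv \<alpha> (\<lambda>x. f \<epsilon> (x + t) - f \<epsilon> x) 0) \<le> C * b \<epsilon> * w (multi_size \<alpha>)"
      using net_bigo_weighted_normE[OF shift[of t] w b] by (metis singletonI)
    \<comment> \<open>n > C enlarges the constant, and n > 1 / e pushes the threshold 1 / (n + 2)
      below e.\<close>
    obtain n :: nat where n: "max C (1 / e) < n"
      using reals_Archimedean2 by blast
    have "1 / (real n + 2) < e"
      using n C(2) by (auto simp: field_simps)
    have "cmod (multi_deriv \<alpha> (f \<epsilon>) t - multi_deriv \<alpha> (f \<epsilon>) 0) \<le> n * b \<epsilon> * w (multi_size \<alpha>)"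
      if \<epsilon>: "\<epsilon> \<in> {0<..<1 / (real n + 2)}" for \<epsilon> \<alpha>
    proof -
      have "cmod (multi_deriv \<alpha> (f \<epsilon>) t - multi_deriv \<alpha> (f \<epsilon>) 0) \<le> C * b \<epsilon> * w (multi_size \<alpha>)"
        using C(3)[of \<epsilon> \<alpha>] \<epsilon> \<open>1 / (real n + 2) < e\<close> sm[OF lt1[OF \<epsilon>]]
        by (simp add: multi_deriv_diff smooth_shift multi_deriv_shift)
      also have "\<dots> \<le> n * b \<epsilon> * w (multi_size \<alpha>)"
        using n b[of \<epsilon>] w[of "multi_size \<alpha>"] by (intro mult_right_mono) auto
      finally show ?thesis .
    qed
    then show ?thesis
      unfolding A_def by blast
  qed
  then have "(\<Union>n. A n) = UNIV"
    by auto
  ultimately obtain n t where "t \<in> interior (A n)"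
    using baire_interior[of A] by auto
  then obtain \<rho> where \<rho>: "\<rho> > 0" "cball t \<rho> \<subseteq> A n"
    using mem_interior_cball by metis
  \<comment> \<open>Half the radius: a segment of length r starting in \<open>cball t r\<close>
    stays in \<open>cball t \<rho>\<close>.\<close>
  define r where "r = \<rho> / 2"
  have r: "r > 0" "\<rho> = 2 * r"
    using \<rho>(1) by (auto simp: r_def)
  have "0 < D"
    using order_less_le_trans[OF w D] w by (meson zero_less_mult_pos2)
  \<comment> \<open>Dominates the constant 2 * n * (D / r + 1) obtained below; the summand 1 keeps E
    positive when n = 0.\<close>
  define E where "E = 4 * n * (D / r + 1) + 1"
  have "cmod (multi_deriv \<alpha> (\<lambda>x. f \<epsilon> x - f \<epsilon> t) y) \<le> E * b \<epsilon> * w (multi_size \<alpha>)"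
    if \<epsilon>: "\<epsilon> \<in> {0<..<1 / (real n + 2)}" and y: "y \<in> cball t r" for \<epsilon> y \<alpha>
  proof -
    let ?g = "\<lambda>\<alpha>. multi_deriv \<alpha> (f \<epsilon>)"
    note sm\<epsilon> = sm[OF lt1[OF \<epsilon>]]
    \<comment> \<open>Both points are compared with the origin, hence the factor 2.\<close>
    have osc: "cmod (?g \<beta> u - ?g \<beta> v) \<le> 2 * n * b \<epsilon> * w (multi_size \<beta>)"
      if "u \<in> cball t \<rho>" "v \<in> cball t \<rho>" for \<beta> u v
    proof -
      have "cmod (?g \<beta> u - ?g \<beta> 0) \<le> n * b \<epsilon> * w (multi_size \<beta>)"
           "cmod (?g \<beta> v - ?g \<beta> 0) \<le> n * b \<epsilon> * w (multi_size \<beta>)"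
        using subsetD[OF \<rho>(2) that(1)] subsetD[OF \<rho>(2) that(2)] \<epsilon> unfolding A_def by auto
      then show ?thesis
        using norm_triangle_ineq4[of "?g \<beta> u - ?g \<beta> 0" "?g \<beta> v - ?g \<beta> 0"] by simp
    qed
    have bw: "0 \<le> b \<epsilon> * w (multi_size \<alpha>)"
      using b[of \<epsilon>] w[of "multi_size \<alpha>"] by simp
    have y\<rho>: "y + s *\<^sub>R axis i 1 \<in> cball t \<rho>" if "s \<in> {0..r}" for s and i :: 'd
      using y r that norm_triangle_ineq4[of "t - y" "s *\<^sub>R axis i 1"]
      by (simp add: dist_norm diff_diff_eq)
    have y': "y \<in> cball t \<rho>"
      using y r by simp
    have "cmod (multi_deriv \<alpha> (\<lambda>x. f \<epsilon> x - f \<epsilon> t) y) \<le>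
        (2 * n * (D / r + 1)) * (b \<epsilon> * w (multi_size \<alpha>))"
    \<comment> \<open>In order 0 the subtraction of f \<epsilon> t leaves an oscillation. In
      positive order the constant disappears, so the derivative itself has to be bounded.\<close>
    proof (cases "multi_size \<alpha> = 0")
      case True
      then have "cmod (multi_deriv \<alpha> (\<lambda>x. f \<epsilon> x - f \<epsilon> t) y) \<le> 2 * n * (b \<epsilon> * w (multi_size \<alpha>))"
        using osc[OF y', of t \<alpha>] r by (simp add: multi_deriv_zero mult_ac)
      also have "\<dots> \<le> (2 * n * (D / r + 1)) * (b \<epsilon> * w (multi_size \<alpha>))"
        using bw r(1) \<open>0 < D\<close> by (intro mult_right_mono) (auto simp: algebra_simps)
      finally show ?thesis .
    next
      case False
      then obtain i \<beta> where i: "?g \<alpha> = partial_deriv i (?g \<beta>)"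
          and size: "multi_size \<alpha> = Suc (multi_size \<beta>)"
        using multi_deriv_split[of \<alpha> "f \<epsilon>"] by auto
      \<comment> \<open>The increment A is the oscillation in the lower order \<beta>, and B is the
        oscillation in order \<alpha>, both available on \<open>cball t \<rho>\<close>.\<close>
      have "cmod (partial_deriv i (?g \<beta>) y) \<le>
          2 * n * b \<epsilon> * w (multi_size \<beta>) / r + 2 * n * b \<epsilon> * w (multi_size \<alpha>)"
        using multi_deriv_differentiable[OF sm\<epsilon>] r(1) osc[OF y\<rho> y'] r(1)
        by (intro norm_partial_deriv_le) (simp_all flip: i)
      \<comment> \<open>The weight of the lower order is exchanged for that of \<alpha> at the cost
        of the factor D, the same in every order.\<close>
      moreover have "2 * n * b \<epsilon> * w (multi_size \<beta>) / r \<le>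
          2 * n * b \<epsilon> * (D * w (multi_size \<alpha>)) / r"
        using r(1) b[of \<epsilon>] D[of "multi_size \<beta>"] unfolding size
        by (intro divide_right_mono mult_left_mono) auto
      ultimately show ?thesis
        using False i sm\<epsilon>
        by (simp add: multi_deriv_diff smooth_const multi_deriv_const algebra_simps)
    qed
    also have "\<dots> \<le> E * (b \<epsilon> * w (multi_size \<alpha>))"
      using bw r(1) \<open>0 < D\<close> unfolding E_def by (intro mult_right_mono) (auto simp: field_simps)
    finally show ?thesis
      by (simp add: mult_ac)
  qed
  moreover have "E > 0"
    using r(1) \<open>0 < D\<close> unfolding E_def by (intro add_nonneg_pos) auto
  ultimately have "net_bigo (\<lambda>\<epsilon>. weighted_norm w (cball t r) (\<lambda>x. f \<epsilon> x - f \<epsilon> t)) b"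
    unfolding net_bigo_weighted_norm_iff[OF w b]
    by (intro exI[of _ E] conjI bexI[of _ "1 / (real n + 2)"]) auto
  with r(1) show thesis
    by (rule that)
qed

text \<open>The radius found near one point t is kept at every centre z, so finitely many balls of
  that radius cover K; weight and rate never change.\<close>

proposition net_bigo_diff_const:
  fixes f :: "real \<Rightarrow> real ^ 'd::finite \<Rightarrow> complex"
  assumes w: "\<And>p. 0 < w p" and D: "\<And>p. w p \<le> D * w (Suc p)" and b: "\<And>\<epsilon>. 0 \<le> b \<epsilon>"
    and sm: "\<And>\<epsilon>. \<epsilon> \<in> {0<..<1} \<Longrightarrow> smooth (f \<epsilon>)"
    and shift: "\<And>h z r. net_bigo (\<lambda>\<epsilon>. weighted_norm w (cball z r) (\<lambda>x. f \<epsilon> (x + h) - f \<epsilon> x)) b"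
    and "compact K"
  shows "net_bigo (\<lambda>\<epsilon>. weighted_norm w K (\<lambda>x. f \<epsilon> x - f \<epsilon> 0)) b"
proof -
  have shift0: "net_bigo (\<lambda>\<epsilon>. weighted_norm w {0} (\<lambda>x. f \<epsilon> (x + h) - f \<epsilon> x)) b" for h
    using shift[of 0 0 h] by simp
  obtain t r where r: "0 < r"
      and t: "net_bigo (\<lambda>\<epsilon>. weighted_norm w (cball t r) (\<lambda>x. f \<epsilon> x - f \<epsilon> t)) b"
    using net_bigo_near_some_point[OF w D b sm shift0] by metis
  have near: "net_bigo (\<lambda>\<epsilon>. weighted_norm w (cball z r) (\<lambda>x. f \<epsilon> x - f \<epsilon> 0)) b" for z
  proof -
    have "(\<lambda>x. x + (t - z)) ` cball z r = cball t r"
      using cball_translation[of "t - z" z r] by (simp add: add.commute)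
    then have 1: "net_bigo (\<lambda>\<epsilon>. weighted_norm w (cball z r) (\<lambda>x. f \<epsilon> (x + (t - z)) - f \<epsilon> t)) b"
      using t by (simp add: weighted_norm_shift[of w "cball z r" "\<lambda>x. f _ x - f _ t"])
    have 2: "net_bigo (\<lambda>\<epsilon>. weighted_norm w (cball z r) (\<lambda>x. f \<epsilon> t - f \<epsilon> 0)) b"
      using net_bigo_point[OF w b shift0[of t]]
      by (intro net_bigo_weighted_norm_const[OF w b]) simp
    \<comment> \<open>f(x) - f(0) is the sum of three negligible parts: g = f(x + (t - z)) - f(t),
      transported from the ball at t; minus h, the hypothesis for the shift t - z; and the constant
      f(t) - f(0), the shift t evaluated at 0.\<close>
    define g h where "g = (\<lambda>\<epsilon> x. f \<epsilon> (x + (t - z)) - f \<epsilon> t)"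
      and "h = (\<lambda>\<epsilon> x. f \<epsilon> (x + (t - z)) - f \<epsilon> x)"
    have sm': "smooth (g \<epsilon>)" "smooth (h \<epsilon>)" "smooth (\<lambda>x. g \<epsilon> x - h \<epsilon> x)" if "\<epsilon> \<in> {0<..<1}" for \<epsilon>
      using sm[OF that] by (auto simp: g_def h_def smooth_diff smooth_shift smooth_const)
    have "net_bigo (\<lambda>\<epsilon>. weighted_norm w (cball z r) (\<lambda>x. g \<epsilon> x - h \<epsilon> x)) b"
    proof (rule net_bigo_weighted_norm_diff[of w b g h, OF w b sm'(1,2)])
      show "net_bigo (\<lambda>\<epsilon>. weighted_norm w (cball z r) (g \<epsilon>)) b"
        using 1 by (simp only: g_def)
      show "net_bigo (\<lambda>\<epsilon>. weighted_norm w (cball z r) (h \<epsilon>)) b"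
        using shift[of z r "t - z"] by (simp only: h_def)
    qed
    then have "net_bigo (\<lambda>\<epsilon>. weighted_norm w (cball z r) (\<lambda>x. g \<epsilon> x - h \<epsilon> x + (f \<epsilon> t - f \<epsilon> 0))) b"
      using net_bigo_weighted_norm_add[of w b "\<lambda>\<epsilon> x. g \<epsilon> x - h \<epsilon> x" "\<lambda>\<epsilon> x. f \<epsilon> t - f \<epsilon> 0",
          OF w b sm'(3) smooth_const _ 2] by simp
    then show ?thesis
      by (simp add: g_def h_def)
  qed
  have "K \<subseteq> (\<Union>z\<in>K. ball z r)"
    using r by auto
  then obtain Z where Z: "finite Z" "K \<subseteq> (\<Union>z\<in>Z. ball z r)"
    using compactE_image[OF \<open>compact K\<close>, of K "\<lambda>z. ball z r"] open_ball by metis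
  have "net_bigo (\<lambda>\<epsilon>. weighted_norm w (\<Union>z\<in>Z. cball z r) (\<lambda>x. f \<epsilon> x - f \<epsilon> 0)) b"
    by (intro net_bigo_weighted_norm_UN w b Z(1) near)
  then show ?thesis
    by (rule net_bigo_weighted_norm_mono) (use Z(2) ball_subset_cball in blast)
qed


section \<open>The two kinds of nets in a uniform notation\<close>

text \<open>Together with \<open>growth_rates\<close>, this isolates all that distinguishes the
  Beurling from the Roumieu case. Moderate and negligible nets then have one quantifier pattern
  each, with the inverse of a rate in the negligible case.\<close>

fun weights :: "ultra_type \<Rightarrow> (nat \<Rightarrow> real) \<Rightarrow> (nat \<Rightarrow> real) set" where
  "weights Beurling M = (\<lambda>h p. h ^ p * M p) ` {0<..}"
| "weights Roumieu M = seq_weight M ` growth_seqs"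

fun growth_rates :: "ultra_type \<Rightarrow> (nat \<Rightarrow> real) \<Rightarrow> (real \<Rightarrow> real) set" where
  "growth_rates Beurling M = (\<lambda>k \<epsilon>. exp (assoc_fun M (k / \<epsilon>))) ` {0..}"
| "growth_rates Roumieu M = (\<lambda>k \<epsilon>. exp (assoc_fun (seq_weight M k) (1 / \<epsilon>))) ` growth_seqs"

lemma growth_rates_pos: "b \<in> growth_rates s M \<Longrightarrow> 0 < b \<epsilon>"
  by (cases s) auto

lemma ultradiff_iff:
  "\<phi> \<in> ultradiff s M \<longleftrightarrow> smooth \<phi> \<and>
     (\<forall>K. regular_compact K \<longrightarrow> (\<forall>w\<in>weights s M. weighted_norm w K \<phi> < \<infinity>))"
  by (cases s) (auto simp: norm_B_def norm_R_def)

lemma moderate_nets_iff: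
  "g \<in> moderate_nets s M \<longleftrightarrow> (\<forall>\<epsilon>\<in>{0<..<1}. g \<epsilon> \<in> ultradiff s M) \<and>
     (\<forall>K. regular_compact K \<longrightarrow> (\<forall>w\<in>weights s M. \<exists>b\<in>growth_rates s M.
        net_bigo (\<lambda>\<epsilon>. weighted_norm w K (g \<epsilon>)) b))"
  by (cases s) (auto simp: ultradiff_nets_def norm_B_def norm_R_def Bex_def)

lemma negligible_nets_iff:
  "g \<in> negligible_nets s M \<longleftrightarrow> (\<forall>\<epsilon>\<in>{0<..<1}. g \<epsilon> \<in> ultradiff s M) \<and>
     (\<forall>K. regular_compact K \<longrightarrow> (\<forall>w\<in>weights s M. \<forall>b\<in>growth_rates s M.
        net_bigo (\<lambda>\<epsilon>. weighted_norm w K (g \<epsilon>)) (\<lambda>\<epsilon>. inverse (b \<epsilon>))))"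
  by (cases s) (auto simp: ultradiff_nets_def norm_B_def norm_R_def exp_minus)

lemma growth_seqs_nonempty: "growth_seqs \<noteq> {}"
proof -
  have "real \<in> growth_seqs"
    by (auto simp: growth_seqs_def mono_on_def filterlim_real_sequentially)
  then show ?thesis by blast
qed

text \<open>Estimates are assumed for all weights; bounding a point value requires that there is at
  least one.\<close>

lemma weights_nonempty: "weights s M \<noteq> {}"
  by (cases s) (auto simp: growth_seqs_nonempty)

lemma weights_pos:
  assumes "weight_sequence M" "w \<in> weights s M"
  shows "0 < w p"
proof (cases s)
  case Roumieu
  then obtain r where "w = seq_weight M r" "r \<in> growth_seqs"
    using assms(2) by auto
  moreover from this have "0 < (\<Prod>i=1..p. r i)"
    by (intro prod_pos) (auto simp: growth_seqs_def)
  ultimately show ?thesis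
    using assms(1) by (auto simp: seq_weight_def weight_sequence_def)
qed (use assms in \<open>auto simp: weight_sequence_def\<close>)

text \<open>By (M.1) the ratios M (p + 1) / M p increase, so each is at least the first one, which
  is M 1 because M 0 = 1.\<close>

lemma weight_sequence_le_Suc:
  assumes "weight_sequence M"
  shows "M 1 * M p \<le> M (Suc p)"
proof (induction p)
  case 0
  then show ?case
    using assms by (simp add: weight_sequence_def)
next
  case (Suc p)
  have pos: "0 < M p" "0 < M (Suc p)" for p
    using assms by (auto simp: weight_sequence_def)
  have logconvex: "\<forall>q\<ge>1. (M q)\<^sup>2 \<le> M (q - 1) * M (q + 1)"
    using assms unfolding weight_sequence_def by blast
  have "M p * (M 1 * M (Suc p)) \<le> M (Suc p) * M (Suc p)"
    using mult_right_mono[OF Suc, of "M (Suc p)"] pos[of p] by (simp add: mult_ac)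
  also have "\<dots> \<le> M p * M (Suc (Suc p))"
    using logconvex[rule_format, of "Suc p"] by (simp add: power2_eq_square)
  finally show ?case
    using pos(1)[of p] by simp
qed

text \<open>Supplies the constant D that pays for a loss of one order. It is 1 / (h * M 1) in the
  Beurling case and 1 / (r 1 * M 1) in the Roumieu case, where r increases.\<close>

lemma weights_le_Suc:
  assumes M: "weight_sequence M" and "w \<in> weights s M"
  obtains D where "\<And>p. w p \<le> D * w (Suc p)"
proof -
  have M1: "0 < M p" for p
    using M by (auto simp: weight_sequence_def)
  have M_le: "M p \<le> M (Suc p) / M 1" for p
    using weight_sequence_le_Suc[OF M] M1[of 1] by (simp add: field_simps)
  show thesis
  proof (cases s)
    case Beurling
    then obtain h where h: "0 < h" "w = (\<lambda>p. h ^ p * M p)"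
      using assms(2) by auto
    have "w p \<le> 1 / (h * M 1) * w (Suc p)" for p
      using mult_left_mono[OF M_le[of p], of "h ^ p"] h by (simp add: field_simps)
    then show thesis by (rule that)
  next
    case Roumieu
    then obtain r where r: "w = seq_weight M r" "r \<in> growth_seqs"
      using assms(2) by auto
    have r1: "0 < r 1" "r 1 \<le> r (Suc p)" for p
      using r(2) by (auto simp: growth_seqs_def mono_on_def)
    have "w p \<le> 1 / (r 1 * M 1) * w (Suc p)" for p
    proof -
      have P: "0 < (\<Prod>i=1..p. r i)"
        using r(2) by (intro prod_pos) (auto simp: growth_seqs_def)
      have "(\<Prod>i=1..p. r i) * M p * r 1 \<le> (\<Prod>i=1..p. r i) * (M (Suc p) / M 1) * r (Suc p)"
        using P M1 r1(1) r1(2)[of p] M_le[of p]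
        by (intro mult_mono mult_left_mono mult_nonneg_nonneg) (auto simp: less_imp_le)
      then show ?thesis
        using r1(1) M1[of 1] by (simp add: r(1) seq_weight_def field_simps)
    qed
    then show thesis by (rule that)
  qed
qed

text \<open>The supremum is a real one and says something only for a bounded set. Boundedness comes
  from (M.3): the ratios M (j - 1) / M j are summable and tend to 0, so \<rho> ^ p / M p eventually
  decreases.\<close>

lemma assoc_fun_nonneg:
  assumes M: "weight_sequence M" and "0 < \<rho>"
  shows "0 \<le> assoc_fun M \<rho>"
proof -
  have pos: "0 < M p" for p
    using M by (auto simp: weight_sequence_def)
  let ?q = "\<lambda>j. M (j - 1) / M j"
  let ?h = "\<lambda>p. max (ln (\<rho> ^ p / M p)) 0"
  have "\<forall>p\<ge>1. ?q summable_on {p + 1..}"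
    using M unfolding weight_sequence_def by blast
  \<comment> \<open>(M.3) at p = 1, its first instance, gives the tail from 2 on; the series is
    extended by 0 below.\<close>
  then have "?q summable_on {2..}"
    by (metis one_add_one order_refl)
  then have "(\<lambda>j. if j \<ge> 2 then ?q j else 0) summable_on UNIV"
    by (rule summable_on_cong_neutral[THEN iffD1, rotated -1]) auto
  then have "summable (\<lambda>j. if j \<ge> 2 then ?q j else 0)"
    using pos by (subst (asm) summable_on_UNIV_nonneg_real_iff) (auto simp: less_imp_le)
  then have "(\<lambda>j. if j \<ge> 2 then ?q j else 0) \<longlonglongrightarrow> 0"
    by (rule summable_LIMSEQ_zero)
  then have "\<forall>\<^sub>F j in sequentially. (if j \<ge> 2 then ?q j else 0) < 1 / \<rho>"
    using \<open>0 < \<rho>\<close> by (intro order_tendstoD) auto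
  then obtain N where N: "\<And>j. j \<ge> N \<Longrightarrow> (if j \<ge> 2 then ?q j else 0) < 1 / \<rho>"
    unfolding eventually_sequentially by blast
  \<comment> \<open>A ratio below 1 / \<rho> is exactly what makes \<rho> ^ p / M p decrease at that
    step; starting at N + 2 keeps the index in the range where the extended series is the
    ratio.\<close>
  have dec: "?h p \<le> ?h (N + 2)" if "p \<ge> N + 2" for p
    using that
  proof (induction p rule: dec_induct)
    case (step p)
    have "M p / M (Suc p) < 1 / \<rho>"
      using N[of "Suc p"] step.hyps by simp
    then have "\<rho> * M p \<le> M (Suc p)"
      using \<open>0 < \<rho>\<close> pos[of "Suc p"] by (simp add: field_simps)
    then have "\<rho> ^ p * (\<rho> * M p) \<le> \<rho> ^ p * M (Suc p)"
      using \<open>0 < \<rho>\<close> by (intro mult_left_mono) auto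
    then have "\<rho> ^ Suc p / M (Suc p) \<le> \<rho> ^ p / M p"
      using pos[of p] pos[of "Suc p"] by (simp add: field_simps)
    then have "ln (\<rho> ^ Suc p / M (Suc p)) \<le> ln (\<rho> ^ p / M p)"
      using pos \<open>0 < \<rho>\<close> by (intro ln_mono) auto
    then show ?case
      using step.IH by linarith
  qed simp
  \<comment> \<open>Finitely many initial values together with a ray bounded above contain the whole
    range.\<close>
  have "?h p \<in> ?h ` {..N + 2} \<union> {..?h (N + 2)}" for p
  proof (cases "p \<le> N + 2")
    case True
    then show ?thesis
      by (intro UnI1 imageI) simp
  next
    case False
    then have "?h p \<le> ?h (N + 2)"
      by (intro dec) simp
    then show ?thesis
      by (intro UnI2 atMost_iff[THEN iffD2])
  qed
  then have "range ?h \<subseteq> ?h ` {..N + 2} \<union> {..?h (N + 2)}"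
    by (rule image_subsetI)
  moreover have "bdd_above (?h ` {..N + 2} \<union> {..?h (N + 2)})"
    unfolding bdd_above_Un by (intro conjI bdd_above_finite bdd_above_Iic) simp
  ultimately have "bdd_above (range ?h)"
    by (rule bdd_above_mono[rotated])
  then have "0 \<le> (SUP p. ?h p)"
    by (rule cSUP_upper2[of _ _ 0]) auto
  then show ?thesis
    by (simp add: assoc_fun_def)
qed

text \<open>
  The growth rates for nets of functions admit \<open>k = 0\<close>, those for numbers do not; as \<open>assoc_fun M\<close>
  is nonnegative, \<open>k = 1\<close> does instead.
\<close>

lemma moderate_numbers_iff:
  assumes "weight_sequence M"
  shows "c \<in> moderate_numbers s M \<longleftrightarrow>
    (\<exists>b\<in>growth_rates s M. net_bigo (\<lambda>\<epsilon>. ennreal (cmod (c \<epsilon>))) b)"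
proof (cases s)
  case Beurling
  have "net_bigo a (\<lambda>\<epsilon>. exp (assoc_fun M (1 / \<epsilon>)))"
    if "net_bigo a (\<lambda>\<epsilon>. exp (assoc_fun M (0 / \<epsilon>)))" for a
  proof -
    have "ennreal (C * exp (assoc_fun M (0 / \<epsilon>))) \<le> ennreal (C * exp (assoc_fun M (1 / \<epsilon>)))"
      if "C > 0" "\<epsilon> > 0" for C \<epsilon>
      using that assoc_fun_nonneg[OF assms, of "1 / \<epsilon>"]
      by (intro ennreal_leI mult_left_mono) (auto simp: assoc_fun_def)
    then show ?thesis
      using that unfolding net_bigo_def by (meson greaterThanLessThan_iff order_trans)
  qed
  then have "(\<exists>k\<ge>0. net_bigo a (\<lambda>\<epsilon>. exp (assoc_fun M (k / \<epsilon>)))) \<longleftrightarrow>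
      (\<exists>k>0. net_bigo a (\<lambda>\<epsilon>. exp (assoc_fun M (k / \<epsilon>))))" for a
    by (metis less_eq_real_def zero_less_one)
  then show ?thesis
    using Beurling by (auto simp: Bex_def)
qed auto

section \<open>Constants and differences in the function spaces, and equality of classes\<close>

lemma ultradiff_const:
  assumes "weight_sequence M"
  shows "(\<lambda>x :: real ^ 'd::finite. c) \<in> ultradiff s M"
proof -
  have "weighted_norm w K (\<lambda>x. c) < \<infinity>" if w: "w \<in> weights s M" for w and K :: "(real ^ 'd) set"
  proof -
    have "cmod (multi_deriv \<alpha> (\<lambda>x. c) x) \<le> cmod c / w 0 * w (multi_size \<alpha>)"
      for \<alpha> and x :: "real ^ 'd"
      using weights_pos[OF assms w, of "multi_size \<alpha>"] weights_pos[OF assms w, of 0]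
      by (auto simp: multi_deriv_const)
    then show ?thesis
      unfolding weighted_norm_finite_iff[of w, OF weights_pos[OF assms w]]
      using weights_pos[OF assms w, of 0] by (intro exI[of _ "cmod c / w 0"]) auto
  qed
  then show ?thesis
    by (simp add: ultradiff_iff smooth_const)
qed

lemma ultradiff_diff:
  assumes M: "weight_sequence M" and \<phi>: "\<phi> \<in> ultradiff s M" and \<psi>: "\<psi> \<in> ultradiff s M"
  shows "(\<lambda>x. \<phi> x - \<psi> x) \<in> ultradiff s M"
proof -
  have sm: "smooth \<phi>" "smooth \<psi>"
    using \<phi> \<psi> by (auto simp: ultradiff_iff)
  have "weighted_norm w K (\<lambda>x. \<phi> x - \<psi> x) < \<infinity>"
    if w: "w \<in> weights s M" and K: "regular_compact K" for w K
  proof -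
    note fin = weighted_norm_finite_iff[of w, OF weights_pos[OF M w]]
    obtain C1 where C1: "C1 \<ge> 0"
        "\<And>x \<alpha>. x \<in> K \<Longrightarrow> cmod (multi_deriv \<alpha> \<phi> x) \<le> C1 * w (multi_size \<alpha>)"
      using \<phi> w K unfolding ultradiff_iff by (metis fin)
    obtain C2 where C2: "C2 \<ge> 0"
        "\<And>x \<alpha>. x \<in> K \<Longrightarrow> cmod (multi_deriv \<alpha> \<psi> x) \<le> C2 * w (multi_size \<alpha>)"
      using \<psi> w K unfolding ultradiff_iff by (metis fin)
    have "cmod (multi_deriv \<alpha> (\<lambda>x. \<phi> x - \<psi> x) x) \<le> (C1 + C2) * w (multi_size \<alpha>)"
      if "x \<in> K" for x \<alpha>
      using order_trans[OF norm_triangle_ineq4 add_mono[OF C1(2)[OF that] C2(2)[OF that]], of \<alpha> \<alpha>]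
      by (simp add: multi_deriv_diff sm algebra_simps)
    then show ?thesis
      unfolding fin using C1(1) C2(1) by (intro exI[of _ "C1 + C2"]) auto
  qed
  then show ?thesis
    by (simp add: ultradiff_iff smooth_diff sm)
qed

lemma negligible_nets_diff:
  assumes M: "weight_sequence M"
    and g: "g \<in> negligible_nets s M" and h: "h \<in> negligible_nets s M"
  shows "(\<lambda>\<epsilon> x. g \<epsilon> x - h \<epsilon> x) \<in> negligible_nets s M"
proof -
  have "smooth (g \<epsilon>)" "smooth (h \<epsilon>)" if "\<epsilon> \<in> {0<..<1}" for \<epsilon>
    using g h that by (auto simp: negligible_nets_iff ultradiff_iff)
  then have "net_bigo (\<lambda>\<epsilon>. weighted_norm w K (\<lambda>x. g \<epsilon> x - h \<epsilon> x)) (\<lambda>\<epsilon>. inverse (b \<epsilon>))"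
    if "regular_compact K" "w \<in> weights s M" "b \<in> growth_rates s M" for K w b
    using that g h weights_pos[OF M that(2)] growth_rates_pos[OF that(3)]
    unfolding negligible_nets_iff
    by (intro net_bigo_weighted_norm_diff) (auto simp: less_imp_le)
  then show ?thesis
    using g h by (simp add: negligible_nets_iff ultradiff_diff[OF M])
qed

lemma gen_class_eqI:
  assumes M: "weight_sequence M" and f: "f \<in> moderate_nets s M" and g: "g \<in> moderate_nets s M"
    and fg: "(\<lambda>\<epsilon> x. f \<epsilon> x - g \<epsilon> x) \<in> negligible_nets s M"
  shows "gen_class s M f = gen_class s M g"
proof -
  note diff = negligible_nets_diff[OF M]
  \<comment> \<open>The negative is obtained from differences alone, as (u - u) - u with u = f -
    g.\<close>
  have gf: "(\<lambda>\<epsilon> x. g \<epsilon> x - f \<epsilon> x) \<in> negligible_nets s M"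
    using diff[OF diff[OF fg fg] fg] by simp
  \<comment> \<open>f - h and g - h differ by f - g, so each is obtained from the other by
    subtracting f - g or g - f.\<close>
  have "(\<lambda>\<epsilon> x. f \<epsilon> x - h \<epsilon> x) \<in> negligible_nets s M \<longleftrightarrow>
        (\<lambda>\<epsilon> x. g \<epsilon> x - h \<epsilon> x) \<in> negligible_nets s M" for h
    using diff[OF _ fg, of "\<lambda>\<epsilon> x. f \<epsilon> x - h \<epsilon> x"] diff[OF _ gf, of "\<lambda>\<epsilon> x. g \<epsilon> x - h \<epsilon> x"]
    by auto
  then show ?thesis
    using f g by (auto simp: gen_class_def net_rel_def)
qed

text \<open>The rate of the number net serves every compact set and every weight.\<close>

lemma moderate_nets_const:
  assumes M: "weight_sequence M" and "c \<in> moderate_numbers s M"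
  shows "(\<lambda>\<epsilon> (x :: real ^ 'd::finite). c \<epsilon>) \<in> moderate_nets s M"
proof -
  obtain b where b: "b \<in> growth_rates s M" "net_bigo (\<lambda>\<epsilon>. ennreal (cmod (c \<epsilon>))) b"
    using assms moderate_numbers_iff by blast
  then have "net_bigo (\<lambda>\<epsilon>. weighted_norm w K (\<lambda>x. c \<epsilon>)) b" if "w \<in> weights s M"
    for w and K :: "(real ^ 'd) set"
    using weights_pos[OF M that] growth_rates_pos[OF b(1)]
    by (intro net_bigo_weighted_norm_const) (auto simp: less_imp_le)
  then show ?thesis
    using b(1) ultradiff_const[OF M] by (auto simp: moderate_nets_iff)
qed

lemma moderate_numbers_point_value:
  assumes M: "weight_sequence M" and f: "f \<in> moderate_nets s M"
  shows "(\<lambda>\<epsilon>. f \<epsilon> x) \<in> moderate_numbers s M"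
proof -
  obtain w where w: "w \<in> weights s M"
    using weights_nonempty by blast
  then obtain b where b: "b \<in> growth_rates s M" "net_bigo (\<lambda>\<epsilon>. weighted_norm w {x} (f \<epsilon>)) b"
    using f regular_compact_convex[of "{x}"] unfolding moderate_nets_iff
    by (meson compact_sing convex_singleton)
  have "net_bigo (\<lambda>\<epsilon>. ennreal (cmod (f \<epsilon> x))) b"
    using weights_pos[OF M w] growth_rates_pos[OF b(1)]
    by (intro net_bigo_point[OF _ _ b(2)]) (auto simp: less_imp_le)
  with b(1) show ?thesis
    using moderate_numbers_iff[OF M] by blast
qed

theorem theorem7:
  fixes M :: "nat \<Rightarrow> real" and s :: ultra_type
    and F :: "(real \<Rightarrow> real ^ 'd::finite \<Rightarrow> complex) set"
    and f :: "real \<Rightarrow> real ^ 'd \<Rightarrow> complex"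
  assumes "weight_sequence M"
    and "F \<in> gen_ultra s M"
    and "f \<in> moderate_nets s M" and "F = gen_class s M f"
    and "\<And>h. (\<lambda>\<epsilon> x. f \<epsilon> (x + h) - f \<epsilon> x) \<in> negligible_nets s M"
  shows "\<exists>C\<in>gen_complex s M. \<exists>c\<in>moderate_numbers s M.
           C = number_class s M c \<and> F = gen_class s M (\<lambda>\<epsilon> x. c \<epsilon>)"
proof -
  define c where "c \<epsilon> = f \<epsilon> 0" for \<epsilon>
  have c: "c \<in> moderate_numbers s M"
    unfolding c_def using assms(1,3) by (rule moderate_numbers_point_value)
  have ud: "f \<epsilon> \<in> ultradiff s M" if "\<epsilon> \<in> {0<..<1}" for \<epsilon>
    using assms(3) that by (simp add: moderate_nets_iff)
  \<comment> \<open>K, w and b are fixed before the Baire argument, so its ball and constants may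
    depend on them; c does not.\<close>
  have "net_bigo (\<lambda>\<epsilon>. weighted_norm w K (\<lambda>x. f \<epsilon> x - c \<epsilon>)) (\<lambda>\<epsilon>. inverse (b \<epsilon>))"
    if K: "regular_compact K" and w: "w \<in> weights s M" and b: "b \<in> growth_rates s M" for K w b
  proof -
    obtain D where D: "\<And>p. w p \<le> D * w (Suc p)"
      using weights_le_Suc[OF assms(1) w] by blast
    show ?thesis
      unfolding c_def
    proof (rule net_bigo_diff_const[of w D, OF weights_pos[OF assms(1) w] D])
      show "0 \<le> inverse (b \<epsilon>)" for \<epsilon>
        using growth_rates_pos[OF b, of \<epsilon>] by simp
      show "smooth (f \<epsilon>)" if "\<epsilon> \<in> {0<..<1}" for \<epsilon>
        using ud[OF that] by (simp add: ultradiff_iff)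
      show "net_bigo (\<lambda>\<epsilon>. weighted_norm w (cball z r) (\<lambda>x. f \<epsilon> (x + h) - f \<epsilon> x))
          (\<lambda>\<epsilon>. inverse (b \<epsilon>))" for h z r
        using assms(5)[of h] w b regular_compact_convex[OF compact_cball convex_cball]
        unfolding negligible_nets_iff by blast
      show "compact K"
        using K by (simp add: regular_compact_def)
    qed
  qed
  then have "(\<lambda>\<epsilon> x. f \<epsilon> x - c \<epsilon>) \<in> negligible_nets s M"
    using ultradiff_diff[OF assms(1) ud ultradiff_const[OF assms(1)]]
    by (simp add: negligible_nets_iff)
  then have "F = gen_class s M (\<lambda>\<epsilon> x. c \<epsilon>)"
    using assms(4) gen_class_eqI[OF assms(1,3) moderate_nets_const[OF assms(1) c]] by simp
  moreover have "number_class s M c \<in> gen_complex s M"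
    unfolding gen_complex_def number_class_def using c by (rule quotientI)
  ultimately show ?thesis
    using c by blast
qed

end
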